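(* Let $r\ge 2$ and let $H$ be an $r$-uniform hypergraph with $n$ vertices and $m\ge 1$ edges, and let $d_i$ be the degree of vertex $i$. Set \[ s(H)=\sum_{i\in V(H)}\left|d_i-\frac{rm}{n}\right|,\qquad v(H)=\frac1n\sum_{i\in V(H)} d_i^{\frac{r}{r-1}}-\left(\frac{rm}{n}\right)^{\frac{r}{r-1}}. \] Then \[ \frac{r-1}{\sqrt[r]{m}}\left(\frac{\sqrt[r]{r!}}{r^r}\right)^{\frac{1}{r-1}}v(H)\le \rho(H)-\frac{rm}{n}\le \frac{r}{\sqrt[r]{r!}}\left(\frac{s(H)}{2}\right)^{\frac{r-1}{r}}. \]
   Context: An $r$-uniform hypergraph $H$ on vertex set $[n]$ has as edges a set of $r$-element subsets of $[n]$ (no multiple edges). The degree $d_i$ of vertex $i$ is the number of edges containing $i$. The adjacency tensor $\mathcal{A}(H)=(a_{i_1\cdots i_r})$ is the order-$r$, dimension-$n$ tensor with $a_{i_1i_2\cdots i_r}=\frac{1}{(r-1)!}$ if $\{i_1,\dots,i_r\}\in E(H)$ and $0$ otherwise. For a tensor $\mathcal{A}$ and $x\in\mathbb{C}^n$, $(\mathcal{A}x)_i=\sum_{i_2,\dots,i_r=1}^n a_{ii_2\cdots i_r}x_{i_2}\cdots x_{i_r}$; $\lambda\in\mathbb{C}$ is an eigenvalue if $\mathcal{A}x=\lambda x^{[r-1]}$ for some nonzero $x\in\mathbb{C}^n$, where $x^{[r-1]}=(x_1^{r-1},\dots,x_n^{r-1})^{\mathrm T}$. The spectral radius $\rho(H)$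 is the maximum modulus of the eigenvalues of $\mathcal{A}(H)$. *)

theory Defs
  imports "HOL-Analysis.Analysis"
begin

text \<open>
  The vertex set \<open>[n]\<close> is the universe of a finite type \<open>'n\<close>, so that \<open>n = CARD('n)\<close>.
  A hypergraph on it is its set of edges.
\<close>

type_synonym 'n hypergraph = "'n set set"

definition uniform_hypergraph :: "nat \<Rightarrow> 'n::finite hypergraph \<Rightarrow> bool" where
  "uniform_hypergraph r H \<longleftrightarrow> (\<forall>e\<in>H. card e = r)"

definition vertex_degree :: "'n::finite hypergraph \<Rightarrow> 'n \<Rightarrow> nat" where
  "vertex_degree H i = card {e \<in> H. i \<in> e}"

text \<open>
  A tensor of order \<open>r\<close> and dimension \<open>CARD('n)\<close> maps an index list \<open>[i\<^sub>1, \<dots>, i\<^sub>r]\<close> to an entry;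
  its values on lists of any other length are irrelevant.
\<close>

type_synonym 'n tensor = "'n list \<Rightarrow> complex"

definition tensor_apply :: "nat \<Rightarrow> 'n::finite tensor \<Rightarrow> complex ^ 'n \<Rightarrow> complex ^ 'n" where
  "tensor_apply r A x =
     (\<chi> i. \<Sum>js | length js = r - 1. A (i # js) * (\<Prod>j\<leftarrow>js. x $ j))"

definition tensor_eigenvalue :: "nat \<Rightarrow> 'n::finite tensor \<Rightarrow> complex \<Rightarrow> bool" where
  "tensor_eigenvalue r A \<mu> \<longleftrightarrow>
     (\<exists>x. x \<noteq> 0 \<and> tensor_apply r A x = (\<chi> i. \<mu> * (x $ i) ^ (r - 1)))"

text \<open>
  \<^const>\<open>Greatest\<close> rather than \<^const>\<open>Max\<close>: the latter is only meaningful for finite sets, and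
  would make finiteness of the spectrum part of the definition.
\<close>

definition tensor_spectral_radius :: "nat \<Rightarrow> 'n::finite tensor \<Rightarrow> real" where
  "tensor_spectral_radius r A = (GREATEST t. \<exists>\<mu>. tensor_eigenvalue r A \<mu> \<and> t = cmod \<mu>)"

text \<open>
  For an \<open>r\<close>-uniform \<open>H\<close> and an index list of length \<open>r\<close>, membership of its set of entries
  in \<open>H\<close> forces the entries to be distinct.
\<close>

definition adjacency_tensor :: "nat \<Rightarrow> 'n::finite hypergraph \<Rightarrow> 'n tensor" where
  "adjacency_tensor r H is = (if set is \<in> H then 1 / fact (r - 1) else 0)"

definition hypergraph_spectral_radius :: "nat \<Rightarrow> 'n::finite hypergraph \<Rightarrow> real" where
  "hypergraph_spectral_radius r H = tensor_spectral_radius r (adjacency_tensor r H)"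

definition average_degree :: "nat \<Rightarrow> 'n::finite hypergraph \<Rightarrow> real" where
  "average_degree r H = real r * real (card H) / real CARD('n)"

definition degree_deviation :: "nat \<Rightarrow> 'n::finite hypergraph \<Rightarrow> real" where
  "degree_deviation r H = (\<Sum>i\<in>UNIV. \<bar>real (vertex_degree H i) - average_degree r H\<bar>)"

definition degree_variance :: "nat \<Rightarrow> 'n::finite hypergraph \<Rightarrow> real" where
  "degree_variance r H =
     (1 / real CARD('n)) * (\<Sum>i\<in>UNIV. real (vertex_degree H i) powr (real r / (real r - 1)))
       - average_degree r H powr (real r / (real r - 1))"

end

theory Submission
  imports Defs "HOL-Combinatorics.Multiset_Permutations"
begin

text \<open>
  For an \<open>r\<close>-uniform \<open>H\<close> put \<open>E(x) = \<Sum>\<^sub>e \<Prod>\<^sub>i\<^sub>\<in>\<^sub>e x\<^sub>i\<close>. The spectral radius \<open>\<rho>\<close> is the maximum of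
  \<open>r E(x)\<close> over \<open>x \<ge> 0\<close> with \<open>\<Sum> x\<^sub>i\<^sup>r = 1\<close>: a maximizer is an eigenvector, and passing to moduli shows
  that no eigenvalue is larger. Let \<open>a = rm/n\<close> be the average degree.

  Upper bound: split the weight of every edge as \<open>1 = (1 - u\<^sub>e) + u\<^sub>e\<close> such that all degrees weighted by
  \<open>1 - u\<^sub>e\<close> are at most \<open>a\<close> while \<open>\<Sum> u\<^sub>e \<le> s(H)/2\<close>. By AM-GM the first part contributes at most \<open>a\<close> to
  \<open>r E(x)\<close>; the second is estimated by Hoelder's inequality and \<open>\<Sum>\<^sub>e \<Prod>\<^sub>i\<^sub>\<in>\<^sub>e x\<^sub>i\<^sup>r \<le> (\<Sum> x\<^sub>i\<^sup>r)\<^sup>r / r!\<close>.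

  Lower bound: let \<open>p = r/(r - 1)\<close> and let \<open>M\<close> be the mean of the \<open>d\<^sub>i\<^sup>p\<close>. The test vector with
  \<open>x\<^sub>i\<^sup>r = d\<^sub>i\<^sup>p / M + (r - 1)\<close> gives \<open>\<rho>\<^sup>p \<ge> M\<close>, hence \<open>v(H) \<le> \<rho>\<^sup>p - a\<^sup>p \<le> p \<rho>\<^sup>p\<^sup>-\<^sup>1 (\<rho> - a)\<close>, and
  \<open>\<rho>\<close> is bounded above in terms of \<open>m\<close> by the Hoelder estimate with all \<open>u\<^sub>e = 1\<close>.
\<close>

subsection \<open>Inequalities and sums over lists\<close>

text \<open>AM-GM for the numbers \<open>y i ^ card A\<close>, from convexity of \<open>exp\<close>
  at the points \<open>card A * ln (y i)\<close>; a vanishing factor is treated apart.\<close>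

lemma prod_le_sum_power:
  fixes y :: "'a \<Rightarrow> real"
  assumes "finite A" "A \<noteq> {}" and nn: "\<And>i. i \<in> A \<Longrightarrow> 0 \<le> y i"
  shows "real (card A) * (\<Prod>i\<in>A. y i) \<le> (\<Sum>i\<in>A. y i ^ card A)"
proof (cases "\<exists>i\<in>A. y i = 0")
  case True
  then have "(\<Prod>i\<in>A. y i) = 0" using assms(1) by (simp add: prod_zero_iff)
  then show ?thesis using nn by (simp add: sum_nonneg)
next
  case False
  then have pos: "0 < y i" if "i \<in> A" for i using nn that by (metis order_le_less)
  let ?c = "real (card A)"
  have c: "?c > 0" using assms by (simp add: card_gt_0_iff)
  have "exp (\<Sum>i\<in>A. (1 / ?c) *\<^sub>R (?c * ln (y i))) \<le> (\<Sum>i\<in>A. (1 / ?c) * exp (?c * ln (y i)))"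
    using assms c by (intro convex_on_sum[OF _ _ exp_convex]) auto
  moreover have "exp (\<Sum>i\<in>A. (1 / ?c) *\<^sub>R (?c * ln (y i))) = (\<Prod>i\<in>A. y i)"
    using c assms pos by (simp add: exp_sum)
  moreover have "exp (?c * ln (y i)) = y i ^ card A" if "i \<in> A" for i
    using pos[OF that] by (simp add: exp_of_nat_mult)
  ultimately have "(\<Prod>i\<in>A. y i) \<le> (\<Sum>i\<in>A. y i ^ card A) / ?c"
    by (simp add: sum_divide_distrib)
  then show ?thesis using c by (simp add: field_simps)
qed

lemma convex_on_power_nonneg: "convex_on {0::real..} (\<lambda>x. x ^ k)"
proof (cases "even k")
  case True
  then show ?thesis using convex_power_even convex_on_subset[of UNIV _ "{0..}"] by auto
next
  case False
  then show ?thesis by (rule convex_power_odd)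
qed

text \<open>Jensen's inequality for \<open>t ^ k\<close> with the normalized weights
  \<open>u i / U\<close>; the weights left on the right are then dropped because
  \<open>u i \<le> 1\<close>.\<close>

lemma power_weighted_sum_le:
  fixes u w :: "'a \<Rightarrow> real"
  assumes "finite A" "k \<ge> 1"
    and u: "\<And>i. i \<in> A \<Longrightarrow> 0 \<le> u i \<and> u i \<le> 1" and w: "\<And>i. i \<in> A \<Longrightarrow> 0 \<le> w i"
  shows "(\<Sum>i\<in>A. u i * w i) ^ k \<le> (\<Sum>i\<in>A. u i) ^ (k - 1) * (\<Sum>i\<in>A. w i ^ k)"
proof (cases "(\<Sum>i\<in>A. u i) = 0")
  case True
  then have "u i = 0" if "i \<in> A" for i
    using sum_nonneg_eq_0_iff[of A u] u that assms(1) by auto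
  then have "(\<Sum>i\<in>A. u i * w i) = 0" by simp
  then show ?thesis using assms w u by (auto simp: zero_power intro!: mult_nonneg_nonneg sum_nonneg zero_le_power)
next
  case False
  define U where "U = (\<Sum>i\<in>A. u i)"
  have "U \<ge> 0" unfolding U_def using u by (intro sum_nonneg) auto
  then have U: "U > 0" using False U_def by auto
  have ne: "A \<noteq> {}" using False by auto
  have "(\<Sum>i\<in>A. (u i / U) *\<^sub>R w i) ^ k \<le> (\<Sum>i\<in>A. (u i / U) * w i ^ k)"
    using assms U ne
    by (intro convex_on_sum[OF _ _ convex_on_power_nonneg])
       (auto simp: U_def sum_divide_distrib[symmetric])
  then have "(\<Sum>i\<in>A. u i * w i) ^ k / U ^ k \<le> (\<Sum>i\<in>A. u i * w i ^ k) / U"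
    by (simp add: sum_divide_distrib[symmetric] power_divide)
  then have "(\<Sum>i\<in>A. u i * w i) ^ k \<le> (\<Sum>i\<in>A. u i * w i ^ k) / U * U ^ k"
    using U by (simp add: pos_divide_le_eq)
  also have "\<dots> = U ^ (k - 1) * (\<Sum>i\<in>A. u i * w i ^ k)"
    using U \<open>k \<ge> 1\<close> by (cases k) auto
  also have "\<dots> \<le> U ^ (k - 1) * (\<Sum>i\<in>A. w i ^ k)"
    using U u w by (intro mult_left_mono sum_mono) (auto intro!: mult_left_le_one_le)
  finally show ?thesis unfolding U_def .
qed

lemma sum_prod_list_length:
  fixes y :: "'a::finite \<Rightarrow> 'b::comm_semiring_1"
  shows "(\<Sum>js | length js = k. \<Prod>j\<leftarrow>js. y j) = (\<Sum>i\<in>UNIV. y i) ^ k"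
proof (induction k)
  case (Suc k)
  have "{js :: 'a list. length js = Suc k} = (\<lambda>(js, i). i # js) ` ({js. length js = k} \<times> UNIV)"
    using lists_length_Suc_eq[of "UNIV :: 'a set" k] by simp
  then have "(\<Sum>js | length js = Suc k. \<Prod>j\<leftarrow>js. y j)
      = (\<Sum>(js, i)\<in>{js. length js = k} \<times> UNIV. y i * (\<Prod>j\<leftarrow>js. y j))"
    by (simp add: sum.reindex inj_split_Cons) (simp add: case_prod_unfold)
  also have "\<dots> = (\<Sum>i\<in>UNIV. y i) ^ Suc k"
    unfolding sum.cartesian_product[symmetric] Suc.IH[symmetric] power_Suc
    by (subst sum.swap) (simp add: sum_product)
  finally show ?case .
qed simp

lemma lists_length_set_eq_permutations:
  assumes "card A = k" "finite A"
  shows "{js. length js = k \<and> set js = A} = permutations_of_set A"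
proof -
  have "length js = k \<longleftrightarrow> distinct js" if "set js = A" for js
    using assms card_distinct[of js] distinct_card[of js] that by metis
  then show ?thesis unfolding permutations_of_set_def by blast
qed

lemma sum_prod_list_permutations:
  fixes y :: "'a::finite \<Rightarrow> 'b::comm_semiring_1"
  shows "(\<Sum>js\<in>permutations_of_set A. \<Prod>j\<leftarrow>js. y j) = of_nat (fact (card A)) * (\<Prod>j\<in>A. y j)"
proof -
  have "(\<Prod>j\<leftarrow>js. y j) = (\<Prod>j\<in>A. y j)" if "js \<in> permutations_of_set A" for js
    using permutations_of_setD[OF that] prod.distinct_set_conv_list[of js y] by simp
  then show ?thesis by simp
qed

subsection \<open>The edge form and the spectral radius\<close>

definition edge_form :: "'n hypergraph \<Rightarrow> ('n \<Rightarrow> 'a::comm_semiring_1) \<Rightarrow> 'a" where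
  "edge_form H x = (\<Sum>e\<in>H. \<Prod>i\<in>e. x i)"

text \<open>The partial derivative of \<open>edge_form\<close> in the variable \<open>i\<close>. The
  coefficient type is generic because complex eigenvectors and their real moduli are both
  inserted.\<close>

definition link_form :: "'n hypergraph \<Rightarrow> 'n \<Rightarrow> ('n \<Rightarrow> 'a::comm_semiring_1) \<Rightarrow> 'a" where
  "link_form H i x = (\<Sum>e | e \<in> H \<and> i \<in> e. \<Prod>j\<in>e - {i}. x j)"

lemma sum_incidence:
  fixes H :: "'n::finite hypergraph"
  shows "(\<Sum>i\<in>UNIV. \<Sum>e | e \<in> H \<and> i \<in> e. f i e) = (\<Sum>e\<in>H. \<Sum>i\<in>e. f i e)"
  using sum.swap_restrict[of "UNIV :: 'n set" H f "\<lambda>i e. i \<in> e"] by simp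

text \<open>Euler's identity in degree \<open>r\<close>: every edge is counted once for each of its
  \<open>r\<close> vertices.\<close>

lemma sum_mult_link_form:
  fixes H :: "'n::finite hypergraph" and x :: "'n \<Rightarrow> 'a::comm_semiring_1"
  assumes "uniform_hypergraph r H"
  shows "(\<Sum>i\<in>UNIV. x i * link_form H i x) = of_nat r * edge_form H x"
proof -
  have "(\<Sum>i\<in>UNIV. x i * link_form H i x)
      = (\<Sum>i\<in>UNIV. \<Sum>e | e \<in> H \<and> i \<in> e. \<Prod>j\<in>e. x j)"
    unfolding link_form_def sum_distrib_left
    by (intro sum.cong refl) (auto simp: prod.remove)
  also have "\<dots> = (\<Sum>e\<in>H. \<Sum>i\<in>e. \<Prod>j\<in>e. x j)" by (rule sum_incidence)
  also have "\<dots> = of_nat r * edge_form H x"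
    using assms by (simp add: edge_form_def sum_distrib_left uniform_hypergraph_def)
  finally show ?thesis .
qed

lemma sum_vertex_degree:
  fixes H :: "'n::finite hypergraph" and g :: "'n \<Rightarrow> real"
  shows "(\<Sum>e\<in>H. \<Sum>i\<in>e. g i) = (\<Sum>i\<in>UNIV. real (vertex_degree H i) * g i)"
  by (simp add: sum_incidence[symmetric] vertex_degree_def)

text \<open>No edge repeats a vertex, so the form is affine in each variable and the increment has
  no higher-order terms.\<close>

lemma edge_form_update:
  fixes H :: "'n::finite hypergraph" and x :: "'n \<Rightarrow> 'a::comm_semiring_1"
  shows "edge_form H (x(i := x i + t)) = edge_form H x + t * link_form H i x"
proof -
  have "(\<Prod>j\<in>e. (x(i := x i + t)) j)
      = (\<Prod>j\<in>e. x j) + (if i \<in> e then t * (\<Prod>j\<in>e - {i}. x j) else 0)" for e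
  proof (cases "i \<in> e")
    case True
    have "(\<Prod>j\<in>e - {i}. (x(i := x i + t)) j) = (\<Prod>j\<in>e - {i}. x j)" by (rule prod.cong) auto
    then show ?thesis using True by (simp add: prod.remove[of e i] distrib_right)
  next
    case False
    then show ?thesis by (auto intro: prod.cong)
  qed
  then show ?thesis
    by (simp add: edge_form_def link_form_def sum.distrib sum_distrib_left sum.If_cases Int_def)
qed

text \<open>An edge through \<open>i\<close> arises from the \<open>fact (r - 1)\<close> orderings
  of its other vertices, which cancels the normalization of the tensor.\<close>

lemma tensor_apply_adjacency_tensor:
  fixes H :: "'n::finite hypergraph"
  assumes H: "uniform_hypergraph r H" and "r \<ge> 1"
  shows "tensor_apply r (adjacency_tensor r H) x $ i = link_form H i (\<lambda>j. x $ j)"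
proof -
  let ?L = "\<lambda>e. {js. length js = r - 1 \<and> set (i # js) = e}"
  have fin: "finite {js :: 'n list. length js = r - 1}"
    using finite_lists_length_eq[of "UNIV :: 'n set" "r - 1"] by simp
  have L: "?L e = permutations_of_set (e - {i})" and c: "card (e - {i}) = r - 1"
    if "e \<in> H" "i \<in> e" for e
  proof -
    have e: "card e = r" using H that by (auto simp: uniform_hypergraph_def)
    then show c: "card (e - {i}) = r - 1" using that by simp
    have "i \<notin> set js" if "js \<in> ?L e" for js
    proof
      assume "i \<in> set js"
      then have "card e \<le> r - 1" using card_length[of js] that by (auto simp: insert_absorb)
      then show False using e \<open>r \<ge> 1\<close> by simp
    qed
    then have "?L e = {js. length js = r - 1 \<and> set js = e - {i}}" using that by auto
    then show "?L e = permutations_of_set (e - {i})"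
      using lists_length_set_eq_permutations[OF c] by simp
  qed
  \<comment> \<open>The case distinction in the tensor entry becomes a sum over at most one edge, so
    that the two summations can be swapped.\<close>
  have "tensor_apply r (adjacency_tensor r H) x $ i
      = (\<Sum>js | length js = r - 1. \<Sum>e | e \<in> H \<and> set (i # js) = e. (\<Prod>j\<leftarrow>js. x $ j) / fact (r - 1))"
  proof -
    have "{e. e \<in> H \<and> S = e} = (if S \<in> H then {S} else {})" for S by auto
    then show ?thesis
      by (simp only: tensor_apply_def adjacency_tensor_def vec_lambda_beta)
         (intro sum.cong refl, simp)
  qed
  also have "\<dots> = (\<Sum>e\<in>H. \<Sum>js\<in>?L e. (\<Prod>j\<leftarrow>js. x $ j) / fact (r - 1))"
    using sum.swap_restrict[OF fin, of H "\<lambda>js e. (\<Prod>j\<leftarrow>js. x $ j) / fact (r - 1)" "\<lambda>js e. set (i # js) = e"]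
    by (simp only: mem_Collect_eq finite)
  also have "\<dots> = (\<Sum>e\<in>H. if i \<in> e then \<Prod>j\<in>e - {i}. x $ j else 0)"
  proof (rule sum.cong[OF refl])
    fix e assume "e \<in> H"
    show "(\<Sum>js\<in>?L e. (\<Prod>j\<leftarrow>js. x $ j) / fact (r - 1)) = (if i \<in> e then \<Prod>j\<in>e - {i}. x $ j else 0)"
    proof (cases "i \<in> e")
      case True
      then show ?thesis unfolding L[OF \<open>e \<in> H\<close> True] using c[OF \<open>e \<in> H\<close> True]
        by (simp add: sum_divide_distrib[symmetric] sum_prod_list_permutations)
    next
      case False
      then have "?L e = {}" by auto
      then show ?thesis using False by (simp only: sum.empty if_False)
    qed
  qed
  also have "\<dots> = link_form H i (\<lambda>j. x $ j)"
    by (simp add: link_form_def sum.If_cases Int_def)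
  finally show ?thesis .
qed

lemma edge_form_scale:
  fixes x :: "'n::finite \<Rightarrow> real"
  assumes "uniform_hypergraph r H"
  shows "edge_form H (\<lambda>i. c * x i) = c ^ r * edge_form H x"
  using assms by (simp add: edge_form_def prod.distrib sum_distrib_left uniform_hypergraph_def)

section \<open>Maximizers of the edge form and the variational principle\<close>

text \<open>The maximum over the compact set \<open>K\<close> exists by continuity; homogeneity of
  degree \<open>r\<close> extends the bound to all nonnegative vectors.\<close>

lemma exists_edge_form_maximizer:
  fixes H :: "'n::finite hypergraph"
  assumes H: "uniform_hypergraph r H" and r: "r \<ge> 1"
  obtains x :: "'n \<Rightarrow> real" where "\<And>i. 0 \<le> x i" "(\<Sum>i\<in>UNIV. x i ^ r) = 1"
    "\<And>y. (\<And>i. 0 \<le> y i) \<Longrightarrow> edge_form H y \<le> edge_form H x * (\<Sum>i\<in>UNIV. y i ^ r)"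
proof -
  define K where "K = {v :: real ^ 'n. (\<forall>i. 0 \<le> v $ i) \<and> (\<Sum>i\<in>UNIV. (v $ i) ^ r) = 1}"
  have "closed K" unfolding K_def
    by (intro closed_Collect_conj closed_Collect_all closed_Collect_le closed_Collect_eq continuous_intros)
  moreover have "bounded K"
  proof (rule boundedI)
    fix v assume v: "v \<in> K"
    have "\<bar>v $ i\<bar> \<le> 1" for i
    proof -
      have "(v $ i) ^ r \<le> (\<Sum>i\<in>UNIV. (v $ i) ^ r)"
        using v by (intro member_le_sum) (auto simp: K_def)
      then have "(v $ i) ^ r \<le> 1 ^ r" using v by (simp add: K_def)
      then have "v $ i \<le> 1" using r by (intro power_le_imp_le_base[of "v $ i" "r - 1" 1]) auto
      then show ?thesis using v by (auto simp: K_def)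
    qed
    then have "(\<Sum>i\<in>UNIV. \<bar>v $ i\<bar>) \<le> (\<Sum>i\<in>(UNIV::'n set). 1)" by (intro sum_mono)
    then show "norm v \<le> real CARD('n)" using norm_le_l1_cart[of v] by simp
  qed
  ultimately have "compact K" by (simp add: compact_eq_bounded_closed)
  moreover have "axis undefined 1 \<in> K"
  proof -
    have "(axis undefined 1 $ i :: real) ^ r = (if i = undefined then 1 else 0)" for i :: 'n
      using r by (auto simp: axis_def)
    then show ?thesis by (simp add: K_def axis_def)
  qed
  moreover have "continuous_on K (\<lambda>v. edge_form H (\<lambda>i. v $ i))"
    unfolding edge_form_def by (intro continuous_intros)
  ultimately obtain v where v: "v \<in> K"
    and max: "\<And>w. w \<in> K \<Longrightarrow> edge_form H (\<lambda>i. w $ i) \<le> edge_form H (\<lambda>i. v $ i)"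
    using continuous_attains_sup[of K] by blast
  show thesis
  proof (rule that)
    show "0 \<le> v $ i" for i using v by (simp add: K_def)
    show "(\<Sum>i\<in>UNIV. (v $ i) ^ r) = 1" using v by (simp add: K_def)
    fix y :: "'n \<Rightarrow> real" assume y: "\<And>i. 0 \<le> y i"
    define s where "s = (\<Sum>i\<in>UNIV. y i ^ r)"
    have s0: "s \<ge> 0" unfolding s_def using y by (intro sum_nonneg) auto
    show "edge_form H y \<le> edge_form H (\<lambda>i. v $ i) * s"
    proof (cases "s = 0")
      case True
      then have "y = (\<lambda>i. 0)"
        using sum_nonneg_eq_0_iff[of UNIV "\<lambda>i. y i ^ r"] y unfolding s_def by (auto simp: fun_eq_iff)
      then have "edge_form H y = edge_form H (\<lambda>i. 0 * y i)" by simp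
      also have "\<dots> = 0" using edge_form_scale[OF H, of 0 y] r by simp
      finally show ?thesis using True by simp
    next
      case False
      \<comment> \<open>The \<open>r\<close>-norm of \<open>y\<close>; dividing by it moves
        \<open>y\<close> into \<open>K\<close>.\<close>
      define c where "c = root r s"
      have c: "c > 0" "c ^ r = s" using False s0 r by (auto simp: c_def)
      define w where "w = (\<chi> i. (1 / c) * y i)"
      have "(\<Sum>i\<in>UNIV. (w $ i) ^ r) = 1"
        using c False by (simp add: w_def power_divide sum_divide_distrib[symmetric] s_def)
      then have "w \<in> K" using y c by (auto simp: K_def w_def)
      from max[OF this] have "edge_form H (\<lambda>i. (1 / c) * y i) \<le> edge_form H (\<lambda>i. v $ i)"
        by (simp add: w_def)
      then have "edge_form H y / s \<le> edge_form H (\<lambda>i. v $ i)"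
        unfolding edge_form_scale[OF H] by (simp add: power_divide c(2))
      then show ?thesis using False s0 by (simp add: divide_le_eq)
    qed
  qed
qed

text \<open>Divide by \<open>t\<close> and let \<open>t\<close> tend to 0. The limit is one-sided
  because a coordinate equal to 0 may only be increased.\<close>

lemma power_increment_derivative_bound:
  fixes a L M :: real
  assumes "\<And>t. t > 0 \<Longrightarrow> t * L \<le> M * ((a + t) ^ r - a ^ r)"
  shows "L \<le> M * (real r * a ^ (r - 1))"
proof -
  have "((\<lambda>x. M * x ^ r) has_real_derivative M * (real r * a ^ (r - 1))) (at a)"
    by (auto intro!: derivative_eq_intros)
  then have "((\<lambda>t. (M * (a + t) ^ r - M * a ^ r) / t) \<longlongrightarrow> M * (real r * a ^ (r - 1))) (at_right 0)"
    unfolding DERIV_def by (rule filterlim_mono[OF _ order_refl]) (simp add: at_le)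
  moreover have "L \<le> (M * (a + t) ^ r - M * a ^ r) / t" if "t > 0" for t
    using assms[OF that] that by (simp add: field_simps)
  then have "\<forall>\<^sub>F t in at_right 0. L \<le> (M * (a + t) ^ r - M * a ^ r) / t"
    by (auto simp: eventually_at_right_less eventually_at_filter)
  ultimately show ?thesis by (rule tendsto_lowerbound) simp
qed

text \<open>The Lagrange condition, obtained by increasing one coordinate at a time. This gives only
  an inequality; Euler's identity makes it sharp where \<open>x i > 0\<close>, and where
  \<open>x i = 0\<close> both sides vanish.\<close>

lemma link_form_maximizer:
  fixes H :: "'n::finite hypergraph" and x :: "'n \<Rightarrow> real"
  assumes H: "uniform_hypergraph r H" and r: "r \<ge> 2"
    and x: "\<And>i. 0 \<le> x i" "(\<Sum>i\<in>UNIV. x i ^ r) = 1"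
    and max: "\<And>y. (\<And>i. 0 \<le> y i) \<Longrightarrow> edge_form H y \<le> edge_form H x * (\<Sum>i\<in>UNIV. y i ^ r)"
  shows "link_form H i x = real r * edge_form H x * x i ^ (r - 1)"
proof -
  have le: "link_form H i x \<le> real r * edge_form H x * x i ^ (r - 1)" for i
  proof -
    have "t * link_form H i x \<le> edge_form H x * ((x i + t) ^ r - x i ^ r)" if "t > 0" for t
    proof -
      have "edge_form H (x(i := x i + t)) \<le> edge_form H x * (\<Sum>j\<in>UNIV. (x(i := x i + t)) j ^ r)"
        using x that by (intro max) (simp add: add_nonneg_nonneg)
      also have "(\<Sum>j\<in>UNIV. (x(i := x i + t)) j ^ r) = (x i + t) ^ r + (\<Sum>j\<in>UNIV - {i}. x j ^ r)"
        by (simp add: sum.remove[of UNIV i])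
      also have "(\<Sum>j\<in>UNIV - {i}. x j ^ r) = 1 - x i ^ r"
        using x(2) by (simp add: sum.remove[of UNIV i])
      finally show ?thesis unfolding edge_form_update by (simp add: algebra_simps)
    qed
    from power_increment_derivative_bound[OF this] show ?thesis by (simp add: mult_ac)
  qed
  have nn: "0 \<le> link_form H i x" for i
    unfolding link_form_def using x by (intro sum_nonneg prod_nonneg) auto
  \<comment> \<open>By Euler's identity the inequalities \<open>le\<close>, weighted by \<open>x i\<close>, sum up to an equality.\<close>
  let ?gap = "\<lambda>i. x i * (real r * edge_form H x * x i ^ (r - 1) - link_form H i x)"
  have "x i * x i ^ (r - 1) = x i ^ r" for i using r by (cases r) auto
  then have "?gap i = real r * edge_form H x * x i ^ r - x i * link_form H i x" for i
    by (simp add: right_diff_distrib mult.left_commute)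
  then have "(\<Sum>i\<in>UNIV. ?gap i)
      = real r * edge_form H x * (\<Sum>i\<in>UNIV. x i ^ r) - (\<Sum>i\<in>UNIV. x i * link_form H i x)"
    by (simp only: sum_subtractf sum_distrib_left)
  also have "\<dots> = 0" by (simp add: x(2) sum_mult_link_form[OF H])
  finally have "?gap i = 0"
    using sum_nonneg_eq_0_iff[of UNIV ?gap] x(1) le by auto
  then show ?thesis
  proof (cases "x i = 0")
    case True
    then show ?thesis using le[of i] nn[of i] r by (simp add: power_0_left split: if_splits)
  qed simp
qed

text \<open>The link between eigenvalues and \<open>edge_form\<close>; later bounds rest on this
  characterization alone.\<close>

lemma hypergraph_spectral_radius_variational:
  fixes H :: "'n::finite hypergraph"
  assumes H: "uniform_hypergraph r H" and r: "r \<ge> 2"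
  obtains x :: "'n \<Rightarrow> real" where "\<And>i. 0 \<le> x i" "(\<Sum>i\<in>UNIV. x i ^ r) = 1"
    "hypergraph_spectral_radius r H = real r * edge_form H x"
    "\<And>y. (\<And>i. 0 \<le> y i) \<Longrightarrow> real r * edge_form H y \<le> hypergraph_spectral_radius r H * (\<Sum>i\<in>UNIV. y i ^ r)"
proof -
  obtain x :: "'n \<Rightarrow> real" where x: "\<And>i. 0 \<le> x i" "(\<Sum>i\<in>UNIV. x i ^ r) = 1"
    and max: "\<And>y. (\<And>i. 0 \<le> y i) \<Longrightarrow> edge_form H y \<le> edge_form H x * (\<Sum>i\<in>UNIV. y i ^ r)"
    by (rule exists_edge_form_maximizer[OF H]) (use r in auto)
  define \<rho> where "\<rho> = real r * edge_form H x"
  have rho0: "\<rho> \<ge> 0" unfolding \<rho>_def edge_form_def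
    using x by (intro mult_nonneg_nonneg sum_nonneg prod_nonneg) auto
  have app: "tensor_apply r (adjacency_tensor r H) z $ i = link_form H i (\<lambda>j. z $ j)" for z i
    using tensor_apply_adjacency_tensor[OF H] r by simp
  have "tensor_eigenvalue r (adjacency_tensor r H) (of_real \<rho>)"
    unfolding tensor_eigenvalue_def
  proof (intro exI conjI)
    define z :: "complex ^ 'n" where "z = (\<chi> i. of_real (x i))"
    show "z \<noteq> 0"
    proof
      assume "z = 0"
      then have "x i = 0" for i by (simp add: z_def vec_eq_iff)
      then show False using x(2) r by (simp add: power_0_left)
    qed
    have "link_form H i (\<lambda>j. z $ j) = of_real (link_form H i x)" for i
      by (simp add: link_form_def z_def)
    then show "tensor_apply r (adjacency_tensor r H) z = (\<chi> i. of_real \<rho> * (z $ i) ^ (r - 1))"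
      using link_form_maximizer[OF H r x max] by (simp add: vec_eq_iff app z_def \<rho>_def)
  qed
  moreover have "cmod \<mu> \<le> \<rho>" if ev: "tensor_eigenvalue r (adjacency_tensor r H) \<mu>" for \<mu>
  proof -
    obtain z :: "complex ^ 'n" where z: "\<exists>i. z $ i \<noteq> 0" and eq: "\<And>i. link_form H i (\<lambda>j. z $ j) = \<mu> * (z $ i) ^ (r - 1)"
      using ev unfolding tensor_eigenvalue_def by (auto simp: vec_eq_iff app)
    let ?y = "\<lambda>i. cmod (z $ i)"
    have "cmod \<mu> * ?y i ^ (r - 1) \<le> link_form H i ?y" for i
    proof -
      have "cmod \<mu> * ?y i ^ (r - 1) = cmod (link_form H i (\<lambda>j. z $ j))"
        by (simp add: eq norm_mult norm_power)
      also have "\<dots> \<le> link_form H i ?y"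
        unfolding link_form_def by (rule order_trans[OF norm_sum]) (simp add: prod_norm)
      finally show ?thesis .
    qed
    \<comment> \<open>Weighting the triangle inequalities by \<open>?y i\<close> and summing allows
      Euler's identity to turn the right side into the edge form.\<close>
    then have "(\<Sum>i\<in>UNIV. ?y i * (cmod \<mu> * ?y i ^ (r - 1))) \<le> (\<Sum>i\<in>UNIV. ?y i * link_form H i ?y)"
      by (intro sum_mono mult_left_mono) auto
    moreover have "?y i * ?y i ^ (r - 1) = ?y i ^ r" for i using r by (cases r) auto
    ultimately have "cmod \<mu> * (\<Sum>i\<in>UNIV. ?y i ^ r) \<le> real r * edge_form H ?y"
      by (simp add: sum_mult_link_form[OF H] sum_distrib_left mult.left_commute)
    also have "\<dots> \<le> \<rho> * (\<Sum>i\<in>UNIV. ?y i ^ r)"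
      using max[of ?y] by (simp add: \<rho>_def mult.assoc mult_left_mono)
    finally have "cmod \<mu> * (\<Sum>i\<in>UNIV. ?y i ^ r) \<le> \<rho> * (\<Sum>i\<in>UNIV. ?y i ^ r)" .
    moreover have "(\<Sum>i\<in>UNIV. ?y i ^ r) > 0"
    proof -
      obtain i where "z $ i \<noteq> 0" using z by blast
      then show ?thesis by (intro sum_pos2[of _ i]) auto
    qed
    ultimately show ?thesis by simp
  qed
  \<comment> \<open>As \<open>\<rho> \<ge> 0\<close>, it is the modulus of its own embedding, so the
    upper bound is attained.\<close>
  ultimately have "hypergraph_spectral_radius r H = \<rho>"
    unfolding hypergraph_spectral_radius_def tensor_spectral_radius_def
    using rho0 by (intro Greatest_equality) (auto intro!: exI[of _ "of_real \<rho>"])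
  then show thesis
    using that[OF x] max by (simp add: \<rho>_def mult.assoc mult_left_mono)
qed

lemma edge_form_le_spectral_radius:
  fixes H :: "'n::finite hypergraph"
  assumes H: "uniform_hypergraph r H" and r: "r \<ge> 2" and y: "\<And>i. 0 \<le> y i"
  shows "real r * edge_form H y \<le> hypergraph_spectral_radius r H * (\<Sum>i\<in>UNIV. y i ^ r)"
  by (rule hypergraph_spectral_radius_variational[OF H r]) (use y in blast)

section \<open>Hoelder-type estimates for edges\<close>

text \<open>In the expansion of the power over all index lists of length \<open>r\<close>, each edge
  occurs in its \<open>fact r\<close> orderings, and the other terms are nonnegative.\<close>

lemma fact_mult_edge_form_le:
  fixes H :: "'n::finite hypergraph" and y :: "'n \<Rightarrow> real"
  assumes H: "uniform_hypergraph r H" and y: "\<And>i. 0 \<le> y i"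
  shows "fact r * edge_form H y \<le> (\<Sum>i\<in>UNIV. y i) ^ r"
proof -
  have fin: "finite {js :: 'n list. length js = r}"
    using finite_lists_length_eq[of "UNIV :: 'n set" r] by simp
  have "fact r * edge_form H y = (\<Sum>e\<in>H. \<Sum>js\<in>permutations_of_set e. \<Prod>j\<leftarrow>js. y j)"
    using H unfolding edge_form_def sum_distrib_left
    by (intro sum.cong refl) (simp add: sum_prod_list_permutations uniform_hypergraph_def)
  also have "\<dots> = (\<Sum>js\<in>(\<Union>e\<in>H. permutations_of_set e). \<Prod>j\<leftarrow>js. y j)"
    by (rule sum.UNION_disjoint[symmetric]) (auto dest: permutations_of_setD(1))
  also have "\<dots> \<le> (\<Sum>js | length js = r. \<Prod>j\<leftarrow>js. y j)"
    using H y fin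
    by (intro sum_mono2)
       (auto simp: uniform_hypergraph_def length_finite_permutations_of_set intro!: prod_list_nonneg)
  finally show ?thesis by (simp add: sum_prod_list_length)
qed

lemma weighted_edge_form_le:
  fixes H :: "'n::finite hypergraph" and x :: "'n \<Rightarrow> real"
  assumes H: "uniform_hypergraph r H" and r: "r \<ge> 2"
    and x: "\<And>i. 0 \<le> x i" "(\<Sum>i\<in>UNIV. x i ^ r) = 1"
    and u: "\<And>e. e \<in> H \<Longrightarrow> 0 \<le> u e \<and> u e \<le> 1"
  shows "(\<Sum>e\<in>H. u e * (\<Prod>i\<in>e. x i)) \<le> (\<Sum>e\<in>H. u e) powr ((real r - 1) / real r) / root r (fact r)"
    (is "?S \<le> ?U powr _ / _")
proof -
  have S0: "0 \<le> ?S" and U0: "0 \<le> ?U"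
    using u x by (auto intro!: sum_nonneg mult_nonneg_nonneg prod_nonneg)
  have "?S ^ r \<le> ?U ^ (r - 1) * (\<Sum>e\<in>H. (\<Prod>i\<in>e. x i) ^ r)"
    using u x r by (intro power_weighted_sum_le) (auto intro!: prod_nonneg)
  also have "(\<Sum>e\<in>H. (\<Prod>i\<in>e. x i) ^ r) = edge_form H (\<lambda>i. x i ^ r)"
    by (simp add: edge_form_def prod_power_distrib)
  also have "?U ^ (r - 1) * edge_form H (\<lambda>i. x i ^ r) \<le> ?U ^ (r - 1) * (1 / fact r)"
    using fact_mult_edge_form_le[OF H, of "\<lambda>i. x i ^ r"] x U0
    by (intro mult_left_mono) (auto simp: field_simps)
  finally have "root r (?S ^ r) \<le> root r (?U ^ (r - 1) * (1 / fact r))"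
    using r by (intro real_root_le_mono) auto
  also have "root r (?U ^ (r - 1) * (1 / fact r)) = root r (?U ^ (r - 1)) / root r (fact r)"
    by (simp add: real_root_divide)
  also have "root r (?U ^ (r - 1)) = ?U powr ((real r - 1) / real r)"
  proof (cases "?U = 0")
    case True
    then show ?thesis using r by simp
  next
    case False
    then have "?U > 0" using U0 by simp
    then show ?thesis using r
      by (simp add: root_powr_inverse powr_realpow[symmetric] powr_powr of_nat_diff)
  qed
  finally show ?thesis using S0 r by (simp add: real_root_power_cancel)
qed

text \<open>Bounds the sum of \<open>\<alpha>\<close> over an edge by the product of a test vector
  over it, which makes degree sums comparable with \<open>edge_form\<close>.\<close>

lemma sum_le_prod_root:
  fixes \<alpha> :: "'a \<Rightarrow> real"
  assumes A: "finite A" "card A = r" and r: "r \<ge> 2" and \<alpha>: "\<And>i. 0 \<le> \<alpha> i"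
  shows "(\<Sum>k\<in>A. \<alpha> k) \<le> (\<Prod>i\<in>A. root r (\<alpha> i ^ r + (real r - 1)))"
proof -
  define N where "N i = root r (\<alpha> i ^ r + (real r - 1))" for i
  \<comment> \<open>Hoelder's inequality for the \<open>r\<close> vectors \<open>k \<mapsto> f k i\<close>, whose \<open>r\<close>-norms are the \<open>N i\<close>.\<close>
  define f where "f k i = (if i = k then \<alpha> k else 1)" for k i
  have pos: "\<alpha> i ^ r + (real r - 1) > 0" for i
    using \<alpha>[of i] r by (intro add_nonneg_pos) auto
  have N: "N i > 0" "N i ^ r = \<alpha> i ^ r + (real r - 1)" for i
    using pos[of i] r by (auto simp: N_def)
  have ne: "A \<noteq> {}" using A r by auto
  have fpow: "f k i ^ r = (if i = k then \<alpha> k ^ r else 1)" for k i by (simp add: f_def)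
  \<comment> \<open>AM-GM for each \<open>k\<close>, after division by the norms; each
    \<open>i\<close> then contributes exactly 1 to the double sum.\<close>
  have "(\<Sum>k\<in>A. real r * (\<Prod>i\<in>A. f k i / N i)) \<le> (\<Sum>k\<in>A. \<Sum>i\<in>A. (f k i / N i) ^ r)"
    using prod_le_sum_power[OF A(1) ne, of "\<lambda>i. f k i / N i" for k] \<alpha> N A
    by (intro sum_mono) (auto simp: f_def less_imp_le)
  also have "\<dots> = (\<Sum>i\<in>A. \<Sum>k\<in>A. (f k i / N i) ^ r)" by (rule sum.swap)
  also have "\<dots> = (\<Sum>i\<in>A. 1)"
  proof (rule sum.cong[OF refl])
    fix i assume i: "i \<in> A"
    have "(\<Sum>k\<in>A. f k i ^ r) = \<alpha> i ^ r + (\<Sum>k\<in>A - {i}. 1)"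
      unfolding fpow sum.remove[OF A(1) i] by (intro arg_cong2[where f = "(+)"] sum.cong) auto
    also have "\<dots> = N i ^ r" using A i r by (simp add: N(2) of_nat_diff)
    finally show "(\<Sum>k\<in>A. (f k i / N i) ^ r) = 1"
      using N(1)[of i] by (simp add: power_divide sum_divide_distrib[symmetric])
  qed
  finally have "(\<Sum>k\<in>A. real r * (\<Prod>i\<in>A. f k i / N i)) \<le> real r" using A by simp
  moreover have "(\<Prod>i\<in>A. f k i) = \<alpha> k" if "k \<in> A" for k
    using A that by (simp add: f_def prod.delta)
  then have "(\<Sum>k\<in>A. real r * (\<Prod>i\<in>A. f k i / N i)) = real r * ((\<Sum>k\<in>A. \<alpha> k) / (\<Prod>i\<in>A. N i))"
    by (simp add: prod_dividef sum_distrib_left sum_divide_distrib)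
  moreover have "(\<Prod>i\<in>A. N i) > 0" using N by (intro prod_pos) auto
  ultimately show ?thesis using r by (simp add: N_def[symmetric] divide_le_eq)
qed

lemma sum_vertex_degree_eq:
  fixes H :: "'n::finite hypergraph"
  assumes "uniform_hypergraph r H"
  shows "(\<Sum>i\<in>UNIV. real (vertex_degree H i)) = real CARD('n) * average_degree r H"
  using sum_vertex_degree[of "\<lambda>_. 1" H] assms
  by (simp add: average_degree_def uniform_hypergraph_def mult.commute)

subsection \<open>Upper bound\<close>

lemma spectral_radius_le_average_degree_plus:
  fixes H :: "'n::finite hypergraph"
  assumes H: "uniform_hypergraph r H" and r: "r \<ge> 2"
  shows "hypergraph_spectral_radius r H - average_degree r H
    \<le> real r / root r (fact r) * (degree_deviation r H / 2) powr ((real r - 1) / real r)"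
proof -
  obtain x :: "'n \<Rightarrow> real" where x: "\<And>i. 0 \<le> x i" "(\<Sum>i\<in>UNIV. x i ^ r) = 1"
    and rho: "hypergraph_spectral_radius r H = real r * edge_form H x"
    by (rule hypergraph_spectral_radius_variational[OF H r]) (rule that)
  define a where "a = average_degree r H"
  define d where "d i = real (vertex_degree H i)" for i
  \<comment> \<open>The fraction of the degree of \<open>i\<close> in excess of \<open>a\<close>; at
    an isolated vertex, division by zero yields the desired value 0.\<close>
  define g where "g i = max 0 (d i - a) / d i" for i
  \<comment> \<open>Removing the fraction \<open>u e\<close> of every edge \<open>e\<close> brings all weighted degrees down to at most \<open>a\<close>.\<close>
  define u where "u e = min 1 (\<Sum>i\<in>e. g i)" for e
  have a: "a \<ge> 0" by (simp add: a_def average_degree_def)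
  have d: "d i \<ge> 0" for i by (simp add: d_def)
  have g: "0 \<le> g i" "g i \<le> 1" for i
    using a d[of i] by (auto simp: g_def divide_le_eq)
  have dg: "d i * g i = max 0 (d i - a)" for i
    using a by (cases "d i = 0") (auto simp: g_def)
  have u: "0 \<le> u e" "u e \<le> 1" for e
    using g by (auto simp: u_def sum_nonneg)
  have gu: "g i \<le> u e" if "i \<in> e" for i e
    using member_le_sum[of i e g] that g by (auto simp: u_def)
  have sum_u: "(\<Sum>e\<in>H. u e) \<le> degree_deviation r H / 2"
  proof -
    have "(\<Sum>e\<in>H. u e) \<le> (\<Sum>e\<in>H. \<Sum>i\<in>e. g i)" by (intro sum_mono) (simp add: u_def)
    also have "\<dots> = (\<Sum>i\<in>UNIV. max 0 (d i - a))"
      unfolding sum_vertex_degree by (simp add: dg flip: d_def)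
    \<comment> \<open>The signed deviations sum to 0, so the total excess is half of the absolute
      deviation.\<close>
    also have "\<dots> = (\<Sum>i\<in>UNIV. (\<bar>d i - a\<bar> + (d i - a)) / 2)"
      by (intro sum.cong refl) (auto simp: max_def)
    also have "\<dots> = (\<Sum>i\<in>UNIV. \<bar>d i - a\<bar>) / 2 + ((\<Sum>i\<in>UNIV. d i) - real CARD('n) * a) / 2"
      by (simp add: sum.distrib sum_subtractf sum_divide_distrib[symmetric] add_divide_distrib diff_divide_distrib)
    also have "\<dots> = degree_deviation r H / 2"
      using sum_vertex_degree_eq[OF H] by (simp add: degree_deviation_def d_def a_def)
    finally show ?thesis .
  qed
  have "real r * (\<Sum>e\<in>H. (1 - u e) * (\<Prod>i\<in>e. x i)) \<le> (\<Sum>e\<in>H. \<Sum>i\<in>e. (1 - u e) * x i ^ r)"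
  proof -
    have "real r * ((1 - u e) * (\<Prod>i\<in>e. x i)) \<le> (\<Sum>i\<in>e. (1 - u e) * x i ^ r)" if e: "e \<in> H" for e
    proof -
      have c: "card e = r" using H e by (simp add: uniform_hypergraph_def)
      then have "real r * (\<Prod>i\<in>e. x i) \<le> (\<Sum>i\<in>e. x i ^ r)"
        using prod_le_sum_power[of e x] x r by fastforce
      then have "(1 - u e) * (real r * (\<Prod>i\<in>e. x i)) \<le> (1 - u e) * (\<Sum>i\<in>e. x i ^ r)"
        using u by (intro mult_left_mono) auto
      then show ?thesis by (simp add: sum_distrib_left mult.left_commute)
    qed
    then show ?thesis unfolding sum_distrib_left by (rule sum_mono)
  qed
  \<comment> \<open>Replacing \<open>u e\<close> by \<open>g i\<close> makes the weight depend on
    the vertex only, so summing over edges produces \<open>d i\<close>.\<close>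
  also have "\<dots> \<le> (\<Sum>e\<in>H. \<Sum>i\<in>e. (1 - g i) * x i ^ r)"
    using gu x by (intro sum_mono mult_right_mono) auto
  also have "\<dots> = (\<Sum>i\<in>UNIV. d i * ((1 - g i) * x i ^ r))"
    unfolding sum_vertex_degree d_def ..
  also have "\<dots> \<le> (\<Sum>i\<in>UNIV. a * x i ^ r)"
  proof (intro sum_mono)
    fix i
    have "d i * (1 - g i) \<le> a" using dg[of i] by (simp add: right_diff_distrib)
    then have "d i * (1 - g i) * x i ^ r \<le> a * x i ^ r" using x by (intro mult_right_mono) auto
    then show "d i * ((1 - g i) * x i ^ r) \<le> a * x i ^ r" by (simp add: mult.assoc)
  qed
  also have "\<dots> = a" using x by (simp flip: sum_distrib_left)
  finally have light: "real r * (\<Sum>e\<in>H. (1 - u e) * (\<Prod>i\<in>e. x i)) \<le> a" .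
  have "(\<Sum>e\<in>H. u e * (\<Prod>i\<in>e. x i)) \<le> (\<Sum>e\<in>H. u e) powr ((real r - 1) / real r) / root r (fact r)"
    using H r x u by (intro weighted_edge_form_le) auto
  also have "\<dots> \<le> (degree_deviation r H / 2) powr ((real r - 1) / real r) / root r (fact r)"
    using sum_u u r by (intro divide_right_mono powr_mono2) (auto intro!: sum_nonneg)
  finally have heavy: "real r * (\<Sum>e\<in>H. u e * (\<Prod>i\<in>e. x i))
      \<le> real r * ((degree_deviation r H / 2) powr ((real r - 1) / real r) / root r (fact r))"
    by (intro mult_left_mono) auto
  have "edge_form H x = (\<Sum>e\<in>H. (1 - u e) * (\<Prod>i\<in>e. x i)) + (\<Sum>e\<in>H. u e * (\<Prod>i\<in>e. x i))"
    by (simp add: edge_form_def sum.distrib[symmetric] algebra_simps)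
  then show ?thesis using light heavy by (simp add: rho a_def distrib_left)
qed

lemma spectral_radius_le_edges:
  fixes H :: "'n::finite hypergraph"
  assumes H: "uniform_hypergraph r H" and r: "r \<ge> 2"
  shows "hypergraph_spectral_radius r H
    \<le> real r * real (card H) powr ((real r - 1) / real r) / root r (fact r)"
proof -
  obtain x :: "'n \<Rightarrow> real" where x: "\<And>i. 0 \<le> x i" "(\<Sum>i\<in>UNIV. x i ^ r) = 1"
    and rho: "hypergraph_spectral_radius r H = real r * edge_form H x"
    by (rule hypergraph_spectral_radius_variational[OF H r]) (rule that)
  have "edge_form H x \<le> real (card H) powr ((real r - 1) / real r) / root r (fact r)"
    using weighted_edge_form_le[OF H _ x, of "\<lambda>_. 1"] r by (simp add: edge_form_def)
  then show ?thesis unfolding rho using r by (simp add: mult_left_mono flip: times_divide_eq_right)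
qed

subsection \<open>Lower bound\<close>

text \<open>The test vector is constantly 1.\<close>

lemma average_degree_le_spectral_radius:
  fixes H :: "'n::finite hypergraph"
  assumes H: "uniform_hypergraph r H" and r: "r \<ge> 2"
  shows "average_degree r H \<le> hypergraph_spectral_radius r H"
proof -
  have "real r * edge_form H (\<lambda>i. 1) \<le> hypergraph_spectral_radius r H * (\<Sum>i\<in>(UNIV::'n set). 1 ^ r)"
    by (rule edge_form_le_spectral_radius[OF H r]) auto
  then show ?thesis by (simp add: edge_form_def average_degree_def divide_le_eq)
qed

lemma degree_power_mean_le_spectral_radius:
  fixes H :: "'n::finite hypergraph"
  assumes H: "uniform_hypergraph r H" and r: "r \<ge> 2" and m: "card H \<ge> 1"
  shows "1 / real CARD('n) * (\<Sum>i\<in>UNIV. real (vertex_degree H i) powr (real r / (real r - 1)))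
    \<le> hypergraph_spectral_radius r H powr (real r / (real r - 1))"
proof -
  define p where "p = real r / (real r - 1)"
  define n where "n = real CARD('n)"
  define d where "d i = real (vertex_degree H i)" for i
  define M where "M = 1 / n * (\<Sum>i\<in>UNIV. d i powr p)"
  \<comment> \<open>Chosen so that \<open>d i * \<alpha> i\<close> is proportional to
    \<open>d i powr p\<close>, while the \<open>\<alpha> i ^ r\<close> have mean 1.\<close>
  define \<alpha> where "\<alpha> i = d i powr (1 / (real r - 1)) / M powr (1 / real r)" for i
  define y where "y i = root r (\<alpha> i ^ r + (real r - 1))" for i
  let ?\<rho> = "hypergraph_spectral_radius r H"
  have n: "n > 0" by (simp add: n_def)
  have d: "d i \<ge> 0" for i by (simp add: d_def)
  have p: "p = 1 + 1 / (real r - 1)" using r by (simp add: p_def field_simps)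
  \<comment> \<open>Some edge exists, so some degree is positive and \<open>M > 0\<close>.\<close>
  obtain e where e: "e \<in> H" using m by (cases "H = {}") auto
  then have "card e = r" using H by (simp add: uniform_hypergraph_def)
  then obtain k where k: "k \<in> e" using r by (cases "e = {}") auto
  have "d k > 0" using e k by (auto simp: d_def vertex_degree_def card_gt_0_iff)
  then have "(\<Sum>i\<in>UNIV. d i powr p) > 0" by (intro sum_pos2[of _ k]) auto
  then have M: "M > 0" using n by (simp add: M_def)
  have nM: "(\<Sum>i\<in>UNIV. d i powr p) = n * M" using n by (simp add: M_def)
  have \<alpha>: "\<alpha> i \<ge> 0" for i by (simp add: \<alpha>_def)
  have \<alpha>r: "\<alpha> i ^ r = d i powr p / M" for i
  proof -
    have "(d i powr (1 / (real r - 1))) ^ r = d i powr p"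
      using r by (cases "d i = 0") (auto simp: powr_power p_def)
    moreover have "(M powr (1 / real r)) ^ r = M" using M r by (simp add: powr_power)
    ultimately show ?thesis by (simp add: \<alpha>_def power_divide)
  qed
  have y: "y i \<ge> 0" "y i ^ r = \<alpha> i ^ r + (real r - 1)" for i
    using \<alpha>[of i] r by (auto simp: y_def)
  have "(\<Sum>i\<in>UNIV. y i ^ r) = (\<Sum>i\<in>UNIV. d i powr p) / M + n * (real r - 1)"
    by (simp add: y(2) \<alpha>r sum.distrib sum_divide_distrib n_def)
  also have "\<dots> = n * real r" using M by (simp add: nM algebra_simps)
  finally have norm_y: "(\<Sum>i\<in>UNIV. y i ^ r) = n * real r" .
  have "d i * \<alpha> i = d i powr p / M powr (1 / real r)" for i
    using d[of i] by (simp add: \<alpha>_def p powr_mult_base)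
  then have "real r * (n * M / M powr (1 / real r)) = real r * (\<Sum>i\<in>UNIV. d i * \<alpha> i)"
    by (simp add: nM flip: sum_divide_distrib)
  also have "\<dots> = real r * (\<Sum>e\<in>H. \<Sum>i\<in>e. \<alpha> i)"
    unfolding sum_vertex_degree d_def ..
  also have "\<dots> \<le> real r * edge_form H y"
  proof -
    have "(\<Sum>e\<in>H. \<Sum>i\<in>e. \<alpha> i) \<le> edge_form H y"
      unfolding edge_form_def y_def
      using H r \<alpha> by (intro sum_mono sum_le_prod_root) (auto simp: uniform_hypergraph_def)
    then show ?thesis by (intro mult_left_mono) auto
  qed
  also have "\<dots> \<le> ?\<rho> * (\<Sum>i\<in>UNIV. y i ^ r)"
    by (rule edge_form_le_spectral_radius[OF H r]) (use y in auto)
  finally have "real r * n * (M / M powr (1 / real r)) \<le> real r * n * ?\<rho>"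
    by (simp add: norm_y mult_ac)
  then have "M / M powr (1 / real r) \<le> ?\<rho>"
    by (rule mult_left_le_imp_le) (use n r in simp)
  moreover have "M / M powr (1 / real r) = M powr (1 - 1 / real r)"
    using M by (simp add: powr_diff)
  ultimately have "(M powr (1 - 1 / real r)) powr p \<le> ?\<rho> powr p"
    using r by (intro powr_mono2) (auto simp: p_def)
  moreover have "(1 - 1 / real r) * p = 1" using r by (simp add: p_def field_simps)
  ultimately have "M \<le> ?\<rho> powr p" using M by (simp only: powr_powr powr_one less_imp_le)
  then show ?thesis by (simp only: M_def n_def d_def p_def)
qed

text \<open>Mean value theorem; the derivative is nondecreasing since
  \<open>p \<ge> 1\<close>.\<close>

lemma powr_diff_le:
  fixes a b p :: real
  assumes "0 < b" "b \<le> a" "p \<ge> 1"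
  shows "a powr p - b powr p \<le> p * a powr (p - 1) * (a - b)"
proof (cases "b = a")
  case False
  then have "b < a" using assms by simp
  then obtain z where z: "b < z" "z < a" "a powr p - b powr p = (a - b) * (p * z powr (p - 1))"
    using MVT2[of b a "\<lambda>x. x powr p" "\<lambda>x. p * x powr (p - 1)"] assms
    by (fastforce intro!: derivative_eq_intros)
  have "z powr (p - 1) \<le> a powr (p - 1)" using z assms by (intro powr_mono2) auto
  then have "(a - b) * (p * z powr (p - 1)) \<le> (a - b) * (p * a powr (p - 1))"
    using \<open>b < a\<close> assms by (intro mult_left_mono) auto
  then show ?thesis by (simp add: z mult_ac)
qed simp

lemma average_degree_plus_le_spectral_radius:
  fixes H :: "'n::finite hypergraph"
  assumes H: "uniform_hypergraph r H" and r: "r \<ge> 2" and m: "card H \<ge> 1"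
  shows "(real r - 1) / root r (real (card H))
           * (root r (fact r) / real r ^ r) powr (1 / (real r - 1)) * degree_variance r H
    \<le> hypergraph_spectral_radius r H - average_degree r H"
proof -
  define p where "p = real r / (real r - 1)"
  define q where "q = 1 / (real r - 1)"
  define \<rho> where "\<rho> = hypergraph_spectral_radius r H"
  define a where "a = average_degree r H"
  define A where "A = root r (real (card H))"
  define F where "F = root r (fact r)"
  \<comment> \<open>The reciprocal of \<open>p * (real r powr q * A / F powr q)\<close>, the bound
    for the derivative \<open>p * \<rho> powr q\<close>.\<close>
  define K where "K = (real r - 1) / A * (F / real r ^ r) powr q"
  have p: "p = 1 + q" "p \<ge> 1" using r by (auto simp: p_def q_def field_simps)
  have q: "q > 0" using r by (simp add: q_def)
  have a: "a > 0" using r m by (simp add: a_def average_degree_def)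
  have a\<rho>: "a \<le> \<rho>" unfolding a_def \<rho>_def by (rule average_degree_le_spectral_radius[OF H r])
  have A: "A > 0" using m r by (simp add: A_def)
  have F: "F > 0" using r by (simp add: F_def)
  have K: "K > 0" using A F r by (simp add: K_def)
  have "\<rho> powr q \<le> (real r * real (card H) powr ((real r - 1) / real r) / F) powr q"
    using spectral_radius_le_edges[OF H r] a a\<rho> q
    by (intro powr_mono2) (auto simp: \<rho>_def F_def)
  also have "\<dots> = real r powr q * A / F powr q"
  proof -
    have "(real r - 1) / real r * q = 1 / real r" using r by (simp add: q_def)
    then have "(real (card H) powr ((real r - 1) / real r)) powr q = A"
      using m r by (simp add: powr_powr A_def root_powr_inverse)
    then show ?thesis using F by (simp add: powr_divide powr_mult)
  qed
  finally have \<rho>q: "\<rho> powr q \<le> real r powr q * A / F powr q" .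
  have "degree_variance r H \<le> \<rho> powr p - a powr p"
    using degree_power_mean_le_spectral_radius[OF H r m]
    by (simp add: degree_variance_def \<rho>_def a_def p_def)
  also have "\<dots> \<le> p * \<rho> powr (p - 1) * (\<rho> - a)"
    using a a\<rho> p by (intro powr_diff_le) auto
  also have "\<dots> \<le> p * (real r powr q * A / F powr q) * (\<rho> - a)"
    using \<rho>q a\<rho> p by (intro mult_right_mono mult_left_mono) auto
  finally have "K * degree_variance r H \<le> K * (p * (real r powr q * A / F powr q) * (\<rho> - a))"
    using K by (intro mult_left_mono) auto
  also have "\<dots> = \<rho> - a"
  proof -
    \<comment> \<open>The extra factor \<open>r\<close> in \<open>r powr p = r * r powr q\<close>
      cancels against \<open>(r - 1) * p = r\<close>.\<close>
    have "(real r ^ r) powr q = real r powr p"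
      using r by (simp add: powr_realpow[symmetric] powr_powr p_def q_def)
    also have "\<dots> = real r * real r powr q" using r by (simp add: p powr_add)
    finally have "K = (real r - 1) / A * (F powr q / (real r * real r powr q))"
      using F by (simp add: K_def powr_divide)
    then have "K * (p * (real r powr q * A / F powr q)) = 1"
      using r A F by (simp add: p_def)
    then show ?thesis by (simp only: mult.assoc[symmetric] mult_1_left)
  qed
  finally show ?thesis by (simp add: K_def A_def F_def q_def \<rho>_def a_def)
qed

theorem theorem1p2:
  fixes r n m :: nat and H :: "'n::finite hypergraph"
  assumes "r \<ge> 2"
    and "uniform_hypergraph r H"
    and "n = CARD('n)"
    and "m = card H"
    and "m \<ge> 1"
  shows "(real r - 1) / root r (real m)
           * (root r (fact r) / real r ^ r) powr (1 / (real r - 1)) * degree_variance r H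
           \<le> hypergraph_spectral_radius r H - real r * real m / real n
       \<and> hypergraph_spectral_radius r H - real r * real m / real n
           \<le> real r / root r (fact r)
               * (degree_deviation r H / 2) powr ((real r - 1) / real r)"
  using average_degree_plus_le_spectral_radius[of r H] spectral_radius_le_average_degree_plus[of r H] assms
  by (simp add: average_degree_def)

end
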